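(* Let $S$ be a compact topological semigroup and suppose that $S$ is left amenable or right amenable. Then $\mathcal{H}^n_{cb}(S)=0$ for every $n\geq1$.
   Context: A topological semigroup is a semigroup $S$ with a topology such that the multiplication $S\times S\to S$ is jointly continuous. For a topological space $X$, $\mathbf{C}(X)$ denotes the Banach space of all bounded continuous complex-valued functions on $X$ with the uniform norm. For a topological semigroup $S$ put $\mathcal{C}^0_{cb}(S)=\mathbb{C}$ and $\mathcal{C}^n_{cb}(S)=\mathbf{C}(S^n)$ for $n\ge1$. Let $\delta^0:\mathcal{C}^0_{cb}(S)\to\mathcal{C}^1_{cb}(S)$ be the zero map, and for $n\ge1$ let $\delta^n:\mathcal{C}^n_{cb}(S)\to\mathcal{C}^{n+1}_{cb}(S)$ be $$\delta^n(f)(s_1,\ldots,s_{n+1})=f(s_2,\ldots,s_{n+1})+\sum_{i=1}^n(-1)^if(s_1,\ldots,s_is_{i+1},\ldots,s_{n+1})+(-1)^{n+1}f(s_1,\ldots,s_n).$$ Then $\delta^{n+1}\delta^n=0$. The continuous bounded cohomology groups of $S$ are $\mathcal{H}^n_{cb}(S)=\ker\delta^n/\operatorname{Im}\delta^{n-1}$ (with $\operatorname{Im}\delta^{-1}=0$). Amenability: for $f\in\mathbf{C}(S)$ and $s\in S$ let $(f\cdot s)(x)=f(sx)$ and $(s\cdot f)(x)=f(xs)$ for $x\in S$. The function $f$ is right (respectively left) uniformly continuous if the map $s\mapsto f\cdot s$ (respectively $s\mapsto s\cdot f$) from $S$ to $\mathbf{C}(S)$ is continuous for the uniform norm; $\mathbf{RUC}(S)$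 (respectively $\mathbf{LUC}(S)$) is the space of all such functions. When $S$ is compact, $\mathbf{RUC}(S)=\mathbf{LUC}(S)=\mathbf{C}(S)$. $S$ is left amenable if there is a bounded linear functional $m$ on $\mathbf{RUC}(S)$ with $\langle m,1_S\rangle=\|m\|=1$ (where $1_S$ is the constant function $1$) and $\langle m,f\cdot s\rangle=\langle m,f\rangle$ for all $s\in S$, $f\in\mathbf{RUC}(S)$. $S$ is right amenable if there is a bounded linear functional $m$ on $\mathbf{LUC}(S)$ with $\langle m,1_S\rangle=\|m\|=1$ and $\langle m,s\cdot f\rangle=\langle m,f\rangle$ for all $s\in S$, $f\in\mathbf{LUC}(S)$. *)

theory Defs
  imports "HOL-Analysis.Analysis" "HOL-Algebra.Elementary_Groups"
begin

section \<open>Continuous bounded cohomology of a topological semigroup\<close>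

text \<open>
  A topological semigroup is a type of class \<open>topological_semigroup_mult\<close>; no separation
  axiom is imposed. A point \<open>(s\<^sub>1,\<dots>,s\<^sub>n)\<close> of \<open>S\<^sup>n\<close> is an
  extensional function on \<open>{1..n}\<close>, and \<open>S\<^sup>n\<close> carries the product topology.
  For \<open>n = 0\<close> this is a one-point space, so the space of bounded continuous
  functions on it is the space of scalars.
\<close>

definition power_top :: "nat \<Rightarrow> (nat \<Rightarrow> 'a::topological_space) topology" where
  "power_top n = product_topology (\<lambda>_. euclidean) {1..n}"

definition bounded_continuous_maps :: "'b topology \<Rightarrow> ('b \<Rightarrow> complex) set" where
  "bounded_continuous_maps X =
     {f \<in> extensional (topspace X). continuous_map X euclidean f \<and> bounded (f ` topspace X)}"

definition bounded_continuous_group :: "'b topology \<Rightarrow> ('b \<Rightarrow> complex) monoid" where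
  "bounded_continuous_group X =
     \<lparr>carrier = bounded_continuous_maps X,
      monoid.mult = (\<lambda>f g. \<lambda>x\<in>topspace X. f x + g x),
      one = (\<lambda>x\<in>topspace X. 0)\<rparr>"

definition cochains :: "nat \<Rightarrow> ((nat \<Rightarrow> 'a::topological_space) \<Rightarrow> complex) monoid" where
  "cochains n = bounded_continuous_group (power_top n)"

text \<open>The maps \<open>S\<^sup>n\<^sup>+\<^sup>1 \<rightarrow> S\<^sup>n\<close> occurring in the coboundary formula:
  \<open>(s\<^sub>2,\<dots>,s\<^sub>n\<^sub>+\<^sub>1)\<close>,
  \<open>(s\<^sub>1,\<dots>,s\<^sub>i s\<^sub>i\<^sub>+\<^sub>1,\<dots>,s\<^sub>n\<^sub>+\<^sub>1)\<close> and
  \<open>(s\<^sub>1,\<dots>,s\<^sub>n)\<close>.\<close>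

definition drop_first :: "nat \<Rightarrow> (nat \<Rightarrow> 'a) \<Rightarrow> nat \<Rightarrow> 'a" where
  "drop_first n s = (\<lambda>j\<in>{1..n}. s (j + 1))"

definition merge_at :: "nat \<Rightarrow> nat \<Rightarrow> (nat \<Rightarrow> 'a::times) \<Rightarrow> nat \<Rightarrow> 'a" where
  "merge_at n i s =
     (\<lambda>j\<in>{1..n}. if j < i then s j else if j = i then s i * s (i + 1) else s (j + 1))"

definition drop_last :: "nat \<Rightarrow> (nat \<Rightarrow> 'a) \<Rightarrow> nat \<Rightarrow> 'a" where
  "drop_last n s = (\<lambda>j\<in>{1..n}. s j)"

definition coboundary ::
  "nat \<Rightarrow> ((nat \<Rightarrow> 'a::topological_semigroup_mult) \<Rightarrow> complex) \<Rightarrow> (nat \<Rightarrow> 'a) \<Rightarrow> complex" where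
  "coboundary n f =
     (\<lambda>s\<in>topspace (power_top (n + 1)).
        if n = 0 then 0
        else f (drop_first n s) + (\<Sum>i=1..n. (-1) ^ i * f (merge_at n i s))
             + (-1) ^ (n + 1) * f (drop_last n s))"

definition cocycles :: "nat \<Rightarrow> ((nat \<Rightarrow> 'a::topological_semigroup_mult) \<Rightarrow> complex) set" where
  "cocycles n = kernel (cochains n) (cochains (n + 1)) (coboundary n)"

definition coboundaries :: "nat \<Rightarrow> ((nat \<Rightarrow> 'a::topological_semigroup_mult) \<Rightarrow> complex) set" where
  "coboundaries n =
     (if n = 0 then {one (cochains 0)} else coboundary (n - 1) ` carrier (cochains (n - 1)))"

definition cb_cohomology ::
  "'a itself \<Rightarrow> nat \<Rightarrow> ((nat \<Rightarrow> 'a::topological_semigroup_mult) \<Rightarrow> complex) set monoid" where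
  "cb_cohomology _ n = (cochains n)\<lparr>carrier := cocycles n\<rparr> Mod coboundaries n"


section \<open>Amenability\<close>

lemma continuous_on_translations:
  fixes s :: "'a::topological_semigroup_mult"
  shows "continuous_on UNIV (\<lambda>x. s * x)" "continuous_on UNIV (\<lambda>x. x * s)"
  unfolding continuous_on_def by (auto intro: tendsto_mult)

definition fun_dot :: "('a::topological_semigroup_mult \<Rightarrow>\<^sub>C complex) \<Rightarrow> 'a \<Rightarrow> ('a \<Rightarrow>\<^sub>C complex)" where
  "fun_dot f s = Bcontfun (\<lambda>x. f (s * x))"

definition dot_fun :: "'a \<Rightarrow> ('a::topological_semigroup_mult \<Rightarrow>\<^sub>C complex) \<Rightarrow> ('a \<Rightarrow>\<^sub>C complex)" where
  "dot_fun s f = Bcontfun (\<lambda>x. f (x * s))"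

definition scaleC_bcontfun ::
  "complex \<Rightarrow> ('a::topological_space \<Rightarrow>\<^sub>C complex) \<Rightarrow> ('a \<Rightarrow>\<^sub>C complex)" where
  "scaleC_bcontfun c f = Bcontfun (\<lambda>x. c * f x)"

text \<open>The functions under \<open>Bcontfun\<close> are indeed bounded and continuous, so the
  abstraction function is never applied outside its domain:\<close>

lemma apply_fun_dot [simp]: "apply_bcontfun (fun_dot f s) x = f (s * x)"
proof -
  have "continuous_on UNIV (\<lambda>x. f (s * x))"
    by (rule continuous_on_compose2[OF _ continuous_on_translations(1)]) auto
  moreover have "bounded (range (\<lambda>x. f (s * x)))"
    by (rule bounded_subset[OF bounded_apply_bcontfun[of f]]) auto
  ultimately show ?thesis
    by (simp add: fun_dot_def Bcontfun_inverse bcontfun_def)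
qed

lemma apply_dot_fun [simp]: "apply_bcontfun (dot_fun s f) x = f (x * s)"
proof -
  have "continuous_on UNIV (\<lambda>x. f (x * s))"
    by (rule continuous_on_compose2[OF _ continuous_on_translations(2)]) auto
  moreover have "bounded (range (\<lambda>x. f (x * s)))"
    by (rule bounded_subset[OF bounded_apply_bcontfun[of f]]) auto
  ultimately show ?thesis
    by (simp add: dot_fun_def Bcontfun_inverse bcontfun_def)
qed

lemma apply_scaleC_bcontfun [simp]: "apply_bcontfun (scaleC_bcontfun c f) x = c * f x"
proof -
  have "continuous_on UNIV (\<lambda>x. c * f x)"
    by (intro continuous_intros) auto
  moreover have "bounded (range (\<lambda>x. c * f x))"
    using bounded_linear_image[OF bounded_apply_bcontfun[of f] bounded_linear_mult_right[of c]]
    by (simp add: image_image)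
  ultimately show ?thesis
    by (simp add: scaleC_bcontfun_def Bcontfun_inverse bcontfun_def)
qed

definition RUC :: "('a::topological_semigroup_mult \<Rightarrow>\<^sub>C complex) set" where
  "RUC = {f. continuous_on UNIV (\<lambda>s. fun_dot f s)}"

definition LUC :: "('a::topological_semigroup_mult \<Rightarrow>\<^sub>C complex) set" where
  "LUC = {f. continuous_on UNIV (\<lambda>s. dot_fun s f)}"

text \<open>Functionals on a subspace \<open>V\<close> are total functions of which only the values on \<open>V\<close>
  matter. The norm below is only meaningful for bounded functionals.\<close>

definition bounded_functional_on ::
  "('a::topological_space \<Rightarrow>\<^sub>C complex) set \<Rightarrow> (('a \<Rightarrow>\<^sub>C complex) \<Rightarrow> complex) \<Rightarrow> bool" where
  "bounded_functional_on V m \<longleftrightarrow>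
     (\<forall>f\<in>V. \<forall>g\<in>V. m (f + g) = m f + m g) \<and>
     (\<forall>c. \<forall>f\<in>V. m (scaleC_bcontfun c f) = c * m f) \<and>
     (\<exists>K. \<forall>f\<in>V. norm (m f) \<le> K * norm f)"

definition functional_norm_on ::
  "('a::topological_space \<Rightarrow>\<^sub>C complex) set \<Rightarrow> (('a \<Rightarrow>\<^sub>C complex) \<Rightarrow> complex) \<Rightarrow> real" where
  "functional_norm_on V m = (SUP f\<in>V. norm (m f) / norm f)"

definition left_amenable :: "'a::topological_semigroup_mult itself \<Rightarrow> bool" where
  "left_amenable _ \<longleftrightarrow>
     (\<exists>m :: ('a \<Rightarrow>\<^sub>C complex) \<Rightarrow> complex.
        bounded_functional_on RUC m \<and>
        m (const_bcontfun 1) = 1 \<and> functional_norm_on RUC m = 1 \<and>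
        (\<forall>s. \<forall>f\<in>RUC. m (fun_dot f s) = m f))"

definition right_amenable :: "'a::topological_semigroup_mult itself \<Rightarrow> bool" where
  "right_amenable _ \<longleftrightarrow>
     (\<exists>m :: ('a \<Rightarrow>\<^sub>C complex) \<Rightarrow> complex.
        bounded_functional_on LUC m \<and>
        m (const_bcontfun 1) = 1 \<and> functional_norm_on LUC m = 1 \<and>
        (\<forall>s. \<forall>f\<in>LUC. m (dot_fun s f) = m f))"

end

theory Submission
  imports Defs
begin

text \<open>
  Average away one variable of a cocycle. Let \<open>m\<close> be a left invariant mean and \<open>f\<close> an
  \<open>n\<close>-cocycle, \<open>n \<ge> 1\<close>. Reading the identity \<open>\<delta> f (s\<^sub>1, \<dots>, s\<^sub>n, x) = 0\<close> as an identity between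
  functions of \<open>x\<close> and applying \<open>m\<close>, the term \<open>f (s\<^sub>1, \<dots>, s\<^sub>n\<^sub>-\<^sub>1, s\<^sub>n x)\<close> loses its factor \<open>s\<^sub>n\<close> by
  invariance, and the last term \<open>f (s\<^sub>1, \<dots>, s\<^sub>n)\<close> does not involve \<open>x\<close>. With
  \<open>h (s\<^sub>1, \<dots>, s\<^sub>n\<^sub>-\<^sub>1)\<close> the mean of \<open>x \<mapsto> f (s\<^sub>1, \<dots>, s\<^sub>n\<^sub>-\<^sub>1, x)\<close>, what remains says
  \<open>f = (-1)\<^sup>n \<delta> h\<close>. For a right invariant mean the averaged variable is inserted in front,
  and the outcome is \<open>f = \<delta> h\<close>. These are
  \<open>left_invariant_mean_cocycle_is_coboundary\<close> and \<open>right_invariant_mean_cocycle_is_coboundary\<close>.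

  The analytic point is that \<open>h\<close> is continuous. As \<open>S\<close> is compact, the tube lemma shows that
  \<open>t \<mapsto> f (t, \<cdot>)\<close> is continuous for the uniform norm (\<open>continuous_map_Bcontfun\<close>), so its composition
  with the bounded functional \<open>m\<close> is continuous. The same lemma shows that every continuous
  function is left and right uniformly continuous, so that \<open>m\<close> is defined on all the functions
  \<open>f (t, \<cdot>)\<close>.

  Vanishing of the quotient group is equality of cocycles and coboundaries, which also
  requires \<open>\<delta> \<delta> = 0\<close>. For this, and for the averaging argument, the three kinds of terms in
  \<open>\<delta>\<close> are treated uniformly: \<open>merge_at n 0\<close> drops the first coordinate and
  \<open>merge_at n (n + 1)\<close> drops the last one, so that \<open>\<delta>\<close> is the alternating sum of
  \<open>f \<circ> merge_at n i\<close> over \<open>0 \<le> i \<le> n + 1\<close>.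
\<close>

section \<open>The cochain complex\<close>

lemma topspace_power_top: "topspace (power_top n) = {1..n} \<rightarrow>\<^sub>E UNIV"
  by (simp add: power_top_def)

lemma carrier_cochains_iff:
  "f \<in> carrier (cochains n) \<longleftrightarrow>
     f \<in> extensional (topspace (power_top n)) \<and> continuous_map (power_top n) euclidean f \<and>
     (\<exists>B. \<forall>s \<in> topspace (power_top n). norm (f s) \<le> B)"
  by (simp add: cochains_def bounded_continuous_group_def bounded_continuous_maps_def bounded_iff)

lemma mult_cochains: "f \<otimes>\<^bsub>cochains n\<^esub> g = (\<lambda>s\<in>topspace (power_top n). f s + g s)"
  by (simp add: cochains_def bounded_continuous_group_def)

lemma one_cochains: "\<one>\<^bsub>cochains n\<^esub> = (\<lambda>s\<in>topspace (power_top n). 0)"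
  by (simp add: cochains_def bounded_continuous_group_def)

lemma restrict_mem_cochains:
  assumes "continuous_map (power_top n) euclidean f"
    and "\<And>s. s \<in> topspace (power_top n) \<Longrightarrow> norm (f s) \<le> B"
  shows "restrict f (topspace (power_top n)) \<in> carrier (cochains n)"
proof -
  have "continuous_map (power_top n) euclidean (restrict f (topspace (power_top n)))"
    by (rule continuous_map_eq[OF assms(1)]) simp
  with assms(2) show ?thesis
    unfolding carrier_cochains_iff by auto
qed

lemma cochains_comm_group: "comm_group (cochains n)"
proof (rule comm_groupI)
  fix f g h :: "(nat \<Rightarrow> 'a) \<Rightarrow> complex"
  assume f: "f \<in> carrier (cochains n)"
  then obtain A where A: "\<forall>s \<in> topspace (power_top n). norm (f s) \<le> A"
    and cf: "continuous_map (power_top n) euclidean f"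
    unfolding carrier_cochains_iff by blast
  show "\<one>\<^bsub>cochains n\<^esub> \<otimes>\<^bsub>cochains n\<^esub> f = f"
    using f unfolding carrier_cochains_iff mult_cochains one_cochains
    by (auto simp: fun_eq_iff restrict_def extensional_def)
  have "restrict (\<lambda>s. - f s) (topspace (power_top n)) \<in> carrier (cochains n)"
    by (rule restrict_mem_cochains[where B = A]) (use A cf in \<open>auto intro: continuous_map_minus\<close>)
  then show "\<exists>g\<in>carrier (cochains n). g \<otimes>\<^bsub>cochains n\<^esub> f = \<one>\<^bsub>cochains n\<^esub>"
    by (rule bexI[rotated]) (auto simp: mult_cochains one_cochains fun_eq_iff)
  assume g: "g \<in> carrier (cochains n)"
  then obtain B where B: "\<forall>s \<in> topspace (power_top n). norm (g s) \<le> B"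
    and cg: "continuous_map (power_top n) euclidean g"
    unfolding carrier_cochains_iff by blast
  show "f \<otimes>\<^bsub>cochains n\<^esub> g \<in> carrier (cochains n)"
    unfolding mult_cochains
    by (rule restrict_mem_cochains[where B = "A + B"])
       (use A B cf cg in \<open>auto intro: continuous_map_add norm_triangle_mono\<close>)
  show "f \<otimes>\<^bsub>cochains n\<^esub> g = g \<otimes>\<^bsub>cochains n\<^esub> f"
    by (auto simp: mult_cochains fun_eq_iff)
  show "f \<otimes>\<^bsub>cochains n\<^esub> g \<otimes>\<^bsub>cochains n\<^esub> h = f \<otimes>\<^bsub>cochains n\<^esub> (g \<otimes>\<^bsub>cochains n\<^esub> h)"
    by (auto simp: mult_cochains fun_eq_iff)
next
  show "\<one>\<^bsub>cochains n\<^esub> \<in> carrier (cochains n)"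
    unfolding one_cochains by (rule restrict_mem_cochains[where B = 0]) auto
qed

lemma continuous_map_times:
  fixes f g :: "'b \<Rightarrow> 'a::topological_semigroup_mult"
  assumes "continuous_map X euclidean f" "continuous_map X euclidean g"
  shows "continuous_map X euclidean (\<lambda>x. f x * g x)"
  using assms by (simp add: continuous_map_atin tendsto_mult)

lemma continuous_map_power_top_coord:
  assumes "j \<in> {1..n}"
  shows "continuous_map (power_top n) euclidean (\<lambda>s. s j)"
  unfolding power_top_def using continuous_map_product_projection[OF assms] by fastforce

lemma continuous_map_into_power_top:
  assumes "\<And>j. j \<in> {1..n} \<Longrightarrow> continuous_map X euclidean (\<lambda>x. f x j)"
    and "\<And>x. f x \<in> extensional {1..n}"
  shows "continuous_map X (power_top n) f"
  using assms unfolding power_top_def continuous_map_componentwise by auto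

lemma merge_at_mem: "merge_at n i s \<in> topspace (power_top n)"
  by (auto simp: merge_at_def topspace_power_top)

lemma continuous_map_merge_at:
  "continuous_map (power_top (Suc n)) (power_top n)
     (merge_at n i :: (nat \<Rightarrow> 'a::topological_semigroup_mult) \<Rightarrow> _)"
proof (rule continuous_map_into_power_top)
  fix j assume j: "j \<in> {1..n}"
  have coord: "continuous_map (power_top (Suc n)) euclidean (\<lambda>s::nat \<Rightarrow> 'a. s k)"
    if "k \<in> {1..Suc n}" for k
    using that by (rule continuous_map_power_top_coord)
  consider "j < i" | "j = i" | "j > i" by linarith
  then show "continuous_map (power_top (Suc n)) euclidean (\<lambda>s::nat \<Rightarrow> 'a. merge_at n i s j)"
  proof cases
    case 2
    then show ?thesis
      using j by (auto simp: merge_at_def intro!: continuous_map_times coord)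
  qed (use j in \<open>auto simp: merge_at_def intro!: coord\<close>)
qed (simp add: merge_at_def)

text \<open>The two outer terms are the values of \<open>merge_at\<close> at the indices \<open>0\<close> and \<open>n + 1\<close>, where its
  case distinction never reaches the product. The formula includes \<open>n = 0\<close>: there the two faces
  coincide and cancel, in accordance with \<open>\<delta>\<^sup>0 = 0\<close>. Degree one therefore needs no separate
  argument below.\<close>

lemma coboundary_eq_alternating_sum:
  assumes "s \<in> topspace (power_top (Suc n))"
  shows "coboundary n f s = (\<Sum>i\<le>Suc n. (-1) ^ i * f (merge_at n i s))"
proof (cases "n = 0")
  case True
  have "merge_at 0 0 s = merge_at 0 (Suc 0) s"
    by (simp add: merge_at_def restrict_def)
  with True assms show ?thesis
    by (simp add: coboundary_def)
next
  case False
  have first: "drop_first n s = merge_at n 0 s"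
    by (auto simp: drop_first_def merge_at_def)
  have last: "drop_last n s = merge_at n (Suc n) s"
    by (auto simp: drop_last_def merge_at_def)
  have "(\<Sum>i\<le>Suc n. (-1) ^ i * f (merge_at n i s)) =
      f (merge_at n 0 s) + (\<Sum>i=1..n. (-1) ^ i * f (merge_at n i s))
      + (-1) ^ Suc n * f (merge_at n (Suc n) s)"
    by (simp add: atMost_atLeast0 sum.atLeast_Suc_atMost)
  with False assms show ?thesis
    by (simp add: coboundary_def first last)
qed

lemma coboundary_mem_cochains:
  assumes "f \<in> carrier (cochains n)"
  shows "coboundary n f \<in> carrier (cochains (Suc n))"
proof -
  obtain B where B: "\<And>s. s \<in> topspace (power_top n) \<Longrightarrow> norm (f s) \<le> B"
    and cont: "continuous_map (power_top n) euclidean f"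
    using assms unfolding carrier_cochains_iff by blast
  have "coboundary n f =
      restrict (\<lambda>s. \<Sum>i\<le>Suc n. (-1) ^ i * f (merge_at n i s)) (topspace (power_top (Suc n)))"
    by (rule ext) (simp add: coboundary_eq_alternating_sum restrict_def, simp add: coboundary_def)
  also have "\<dots> \<in> carrier (cochains (Suc n))"
  proof (rule restrict_mem_cochains)
    have face: "continuous_map (power_top (Suc n)) euclidean (\<lambda>s. f (merge_at n i s))" for i
      using continuous_map_compose[OF continuous_map_merge_at cont] by (simp add: o_def)
    have "continuous_map (power_top (Suc n)) euclidean (\<lambda>s. (-1) ^ i * f (merge_at n i s))" for i
      by (rule continuous_map_times) (use face in simp_all)
    then show "continuous_map (power_top (Suc n)) euclidean
        (\<lambda>s. \<Sum>i\<le>Suc n. (-1) ^ i * f (merge_at n i s))"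
      by (intro continuous_map_sum) auto
    show "norm (\<Sum>i\<le>Suc n. (-1) ^ i * f (merge_at n i s)) \<le> of_nat (card {..Suc n}) * B" for s
      by (rule sum_norm_bound) (simp add: norm_mult norm_power B[OF merge_at_mem])
  qed
  finally show ?thesis .
qed

lemma coboundary_group_hom:
  "group_hom (cochains n) (cochains (Suc n))
     (coboundary n :: ((nat \<Rightarrow> 'a::topological_semigroup_mult) \<Rightarrow> complex) \<Rightarrow> _)"
proof -
  have "coboundary n (f \<otimes>\<^bsub>cochains n\<^esub> g) =
      coboundary n f \<otimes>\<^bsub>cochains (Suc n)\<^esub> coboundary n g"
    for f g :: "(nat \<Rightarrow> 'a) \<Rightarrow> complex"
  proof
    fix s :: "nat \<Rightarrow> 'a"
    show "coboundary n (f \<otimes>\<^bsub>cochains n\<^esub> g) s =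
      (coboundary n f \<otimes>\<^bsub>cochains (Suc n)\<^esub> coboundary n g) s"
    proof (cases "s \<in> topspace (power_top (Suc n))")
      case True
      then show ?thesis
        by (simp add: coboundary_eq_alternating_sum mult_cochains merge_at_mem sum.distrib
            distrib_left del: sum.atMost_Suc)
    qed (simp add: mult_cochains coboundary_def)
  qed
  then have "(coboundary n :: ((nat \<Rightarrow> 'a) \<Rightarrow> complex) \<Rightarrow> _) \<in> hom (cochains n) (cochains (Suc n))"
    by (auto simp: hom_def coboundary_mem_cochains)
  then show ?thesis
    by (simp add: group_hom_def group_hom_axioms_def comm_group.axioms(2) cochains_comm_group)
qed

text \<open>The combinatorial core of \<open>\<delta> \<delta> = 0\<close>: the entries strictly below the diagonal are matched
  with those on and above it by \<open>(Suc j, i) \<leftrightarrow> (i, j)\<close>, which changes the parity of the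
  index sum.\<close>

lemma alternating_double_sum_eq_0:
  fixes F :: "nat \<Rightarrow> nat \<Rightarrow> 'b::comm_ring_1"
  assumes "\<And>i j. i \<le> j \<Longrightarrow> F (Suc j) i = F i j"
  shows "(\<Sum>a\<le>Suc N. \<Sum>b\<le>N. (-1) ^ (a + b) * F a b) = 0"
proof -
  let ?t = "\<lambda>(a, b). (-1) ^ (a + b) * F a b"
  let ?L = "{(a, b). a \<le> Suc N \<and> b \<le> N \<and> b < a}"
  let ?U = "{(a, b). a \<le> Suc N \<and> b \<le> N \<and> a \<le> b}"
  have fin: "finite ?L" "finite ?U"
    by (rule finite_subset[of _ "{..Suc N} \<times> {..N}"]; auto)+
  have "(\<Sum>a\<le>Suc N. \<Sum>b\<le>N. (-1) ^ (a + b) * F a b) = sum ?t ({..Suc N} \<times> {..N})"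
    by (rule sum.cartesian_product)
  also have "{..Suc N} \<times> {..N} = ?L \<union> ?U"
    by auto
  also have "sum ?t (?L \<union> ?U) = sum ?t ?L + sum ?t ?U"
    by (rule sum.union_disjoint) (use fin in auto)
  also have "sum ?t ?L = sum (\<lambda>p. - ?t p) ?U"
    by (rule sum.reindex_bij_witness[of _ "\<lambda>(i, j). (Suc j, i)" "\<lambda>(a, b). (b, a - 1)"])
       (auto simp: assms[symmetric] add.commute gr0_conv_Suc less_Suc_eq_le elim!: less_natE)
  finally show ?thesis
    by (simp add: sum_negf)
qed

text \<open>The simplicial identities. Associativity is used exactly in the case \<open>i = j\<close>, where three
  neighbouring coordinates are multiplied.\<close>

lemma merge_at_merge_at:
  fixes s :: "nat \<Rightarrow> 'a::semigroup_mult"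
  assumes "i \<le> j"
  shows "merge_at n i (merge_at (Suc n) (Suc j) s) = merge_at n j (merge_at (Suc n) i s)"
  using assms by (auto simp: merge_at_def fun_eq_iff mult.assoc)

lemma coboundary_coboundary:
  fixes f :: "(nat \<Rightarrow> 'a::topological_semigroup_mult) \<Rightarrow> complex"
  shows "coboundary (Suc n) (coboundary n f) = \<one>\<^bsub>cochains (Suc (Suc n))\<^esub>"
proof
  fix s :: "nat \<Rightarrow> 'a"
  show "coboundary (Suc n) (coboundary n f) s = \<one>\<^bsub>cochains (Suc (Suc n))\<^esub> s"
  proof (cases "s \<in> topspace (power_top (Suc (Suc n)))")
    case True
    have "coboundary (Suc n) (coboundary n f) s =
        (\<Sum>a\<le>Suc (Suc n). \<Sum>b\<le>Suc n.
            (-1) ^ (a + b) * f (merge_at n b (merge_at (Suc n) a s)))"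
      using True
      by (simp add: coboundary_eq_alternating_sum merge_at_mem sum_distrib_left power_add
          mult.assoc del: sum.atMost_Suc)
    also have "\<dots> = 0"
      by (rule alternating_double_sum_eq_0) (simp add: merge_at_merge_at)
    finally show ?thesis
      using True by (simp add: one_cochains)
  qed (simp add: one_cochains coboundary_def)
qed

lemma coboundaries_subset_cocycles: "coboundaries (Suc n) \<subseteq> cocycles (Suc n)"
  by (auto simp: coboundaries_def cocycles_def kernel_def coboundary_mem_cochains
      coboundary_coboundary)

lemma trivial_cohomologyI:
  assumes "cocycles (Suc n) \<subseteq> (coboundaries (Suc n) ::
      ((nat \<Rightarrow> 'a::topological_semigroup_mult) \<Rightarrow> complex) set)"
  shows "trivial_group (cb_cohomology TYPE('a) (Suc n))"
proof -
  let ?Z = "cocycles (Suc n) :: ((nat \<Rightarrow> 'a) \<Rightarrow> complex) set"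
  define G where "G = (cochains (Suc n))\<lparr>carrier := ?Z\<rparr>"
  interpret \<delta>: group_hom "cochains (Suc n)" "cochains (Suc (Suc n))"
      "coboundary (Suc n) :: ((nat \<Rightarrow> 'a) \<Rightarrow> complex) \<Rightarrow> _"
    by (rule coboundary_group_hom)
  have "subgroup ?Z (cochains (Suc n))"
    using \<delta>.subgroup_kernel by (simp add: cocycles_def)
  then interpret G: group G
    unfolding G_def by (rule subgroup.subgroup_is_group) (rule \<delta>.G.is_group)
  have "coboundaries (Suc n) = carrier G"
    using assms coboundaries_subset_cocycles by (auto simp: G_def)
  then have "cb_cohomology TYPE('a) (Suc n) = G Mod carrier G"
    by (simp add: cb_cohomology_def G_def)
  moreover have "trivial_group (G\<lparr>carrier := {\<one>\<^bsub>G\<^esub>}\<rparr>)"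
    using G.subgroup_imp_group[OF G.triv_subgroup] by (simp add: trivial_group_def)
  ultimately show ?thesis
    using isomorphic_group_triviality[OF is_isoI[OF G.self_factor_iso]]
      normal.factorgroup_is_group[OF G.normal_self] G.subgroup_imp_group[OF G.triv_subgroup]
    by simp
qed


section \<open>Averaging over a compact semigroup\<close>

lemma Bcontfun_inverse_compact:
  fixes \<phi> :: "'a::topological_space \<Rightarrow> complex"
  assumes "compact (UNIV :: 'a set)" "continuous_on UNIV \<phi>"
  shows "apply_bcontfun (Bcontfun \<phi>) = \<phi>"
  using assms compact_continuous_image[OF assms(2,1)]
  by (simp add: Bcontfun_inverse bcontfun_def compact_imp_bounded)

lemma continuous_map_fix_first:
  assumes "continuous_map (prod_topology Y X) Z (\<lambda>(y, x). F y x)" "y \<in> topspace Y"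
  shows "continuous_map X Z (F y)"
proof -
  have "continuous_map X (prod_topology Y X) (\<lambda>x. (y, x))"
    using assms(2) by (intro continuous_map_pairedI) auto
  from continuous_map_compose[OF this assms(1)] show ?thesis
    by (simp add: o_def)
qed

text \<open>A jointly continuous function of two variables is uniformly close to its slice at \<open>y\<close>
  for parameters near \<open>y\<close>, by the tube lemma for the compact second factor. Consequently
  compactness makes every continuous function uniformly continuous on both sides, and averages
  of cochains continuous.\<close>

lemma continuous_map_Bcontfun:
  fixes F :: "'b \<Rightarrow> 'a::topological_space \<Rightarrow> complex"
  assumes compact: "compact (UNIV :: 'a set)"
    and cont: "continuous_map (prod_topology Y euclidean) euclidean (\<lambda>(y, x). F y x)"
  shows "continuous_map Y euclidean (\<lambda>y. Bcontfun (F y))"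
proof -
  have slice: "continuous_on UNIV (F y)" if "y \<in> topspace Y" for y
    using continuous_map_fix_first[OF cont that] by simp
  note apply_F = Bcontfun_inverse_compact[OF compact slice]
  have "\<exists>U. openin Y U \<and> y \<in> U \<and> (\<forall>z\<in>U. dist (Bcontfun (F y)) (Bcontfun (F z)) < e)"
    if y: "y \<in> topspace Y" and e: "e > 0" for y e
  proof -
    let ?W = "{p \<in> topspace (prod_topology Y euclidean).
      dist (F y (snd p)) (F (fst p) (snd p)) \<in> {..<e/2}}"
    have "continuous_map (prod_topology Y euclidean) euclidean (\<lambda>p. F y (snd p))"
      using continuous_map_compose[OF continuous_map_snd, of euclidean euclidean "F y" Y] slice[OF y]
      by (simp add: o_def)
    moreover have "continuous_map (prod_topology Y euclidean) euclidean (\<lambda>p. F (fst p) (snd p))"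
      using cont by (simp add: case_prod_unfold)
    ultimately have "continuous_map (prod_topology Y euclidean) euclidean
        (\<lambda>p. dist (F y (snd p)) (F (fst p) (snd p)))"
      by (simp add: continuous_map_atin tendsto_dist)
    then have "openin (prod_topology Y euclidean) ?W"
      by (rule openin_continuous_map_preimage) simp
    then obtain U V where U: "openin Y U" "y \<in> U" "UNIV \<subseteq> V" "U \<times> V \<subseteq> ?W"
      using tube_lemma_right[of Y euclidean ?W UNIV y] compact y e by fastforce
    have "dist (Bcontfun (F y)) (Bcontfun (F z)) < e" if "z \<in> U" for z
    proof -
      have z: "z \<in> topspace Y"
        using U(1) that openin_subset by blast
      have "dist (F y x) (F z x) \<le> e/2" for x
      proof -
        have "(z, x) \<in> ?W"
          using U(3,4) that by blast
        then show ?thesis by simp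
      qed
      then have "dist (Bcontfun (F y)) (Bcontfun (F z)) \<le> e/2"
        by (intro dist_bound) (simp add: apply_F y z)
      with e show ?thesis by simp
    qed
    with U show ?thesis by blast
  qed
  then show ?thesis
    by (auto simp: Met_TC.continuous_map_to_metric simp flip: mtopology_is_euclidean)
qed

lemma RUC_eq_UNIV:
  assumes "compact (UNIV :: 'a::topological_semigroup_mult set)"
  shows "(RUC :: ('a \<Rightarrow>\<^sub>C complex) set) = UNIV"
proof -
  have "continuous_on UNIV (fun_dot f)" for f :: "'a \<Rightarrow>\<^sub>C complex"
  proof -
    have "continuous_map euclidean euclidean (\<lambda>p :: 'a \<times> 'a. fst p * snd p)"
      by (rule continuous_map_times) (simp_all add: continuous_on_fst continuous_on_snd)
    then have "continuous_on UNIV (\<lambda>p. f (fst p * snd p))"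
      by (intro continuous_on_compose2[OF continuous_on_apply_bcontfun]) auto
    then have "continuous_map (prod_topology euclidean euclidean) euclidean (\<lambda>(s, x). f (s * x))"
      by (simp add: case_prod_unfold)
    from continuous_map_Bcontfun[OF assms this] show ?thesis
      by (simp add: fun_dot_def[abs_def])
  qed
  then show ?thesis by (auto simp: RUC_def)
qed

lemma LUC_eq_UNIV:
  assumes "compact (UNIV :: 'a::topological_semigroup_mult set)"
  shows "(LUC :: ('a \<Rightarrow>\<^sub>C complex) set) = UNIV"
proof -
  have "continuous_on UNIV (\<lambda>s. dot_fun s f)" for f :: "'a \<Rightarrow>\<^sub>C complex"
  proof -
    have "continuous_map euclidean euclidean (\<lambda>p :: 'a \<times> 'a. snd p * fst p)"
      by (rule continuous_map_times) (simp_all add: continuous_on_fst continuous_on_snd)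
    then have "continuous_on UNIV (\<lambda>p. f (snd p * fst p))"
      by (intro continuous_on_compose2[OF continuous_on_apply_bcontfun]) auto
    then have "continuous_map (prod_topology euclidean euclidean) euclidean (\<lambda>(s, x). f (x * s))"
      by (simp add: case_prod_unfold)
    from continuous_map_Bcontfun[OF assms this] show ?thesis
      by (simp add: dot_fun_def[abs_def])
  qed
  then show ?thesis by (auto simp: LUC_def)
qed


lemma bounded_functional_on_continuous:
  fixes m :: "('a::topological_space \<Rightarrow>\<^sub>C complex) \<Rightarrow> complex"
  assumes m: "bounded_functional_on UNIV m"
  shows "continuous_on UNIV m"
proof -
  obtain K where K: "\<And>\<phi>. norm (m \<phi>) \<le> K * norm \<phi>"
    using m unfolding bounded_functional_on_def by auto
  have "scaleC_bcontfun (of_real r) \<phi> = r *\<^sub>R \<phi>" for r \<phi>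
    by (rule bcontfun_eqI) (simp add: scaleR_conv_of_real)
  then have "m (r *\<^sub>R \<phi>) = r *\<^sub>R m \<phi>" for r \<phi>
    using m unfolding bounded_functional_on_def by (metis UNIV_I scaleR_conv_of_real)
  moreover have "m (\<phi> + \<psi>) = m \<phi> + m \<psi>" for \<phi> \<psi>
    using m unfolding bounded_functional_on_def by blast
  ultimately have "bounded_linear m"
    using K by (intro bounded_linear_intro[of m K]) (simp_all add: mult.commute)
  then show ?thesis
    by (rule linear_continuous_on)
qed

lemma bounded_functional_on_sum:
  fixes \<phi> :: "nat \<Rightarrow> 'a::topological_space \<Rightarrow> complex"
    and m :: "('a \<Rightarrow>\<^sub>C complex) \<Rightarrow> complex"
  assumes compact: "compact (UNIV :: 'a set)"
    and m: "bounded_functional_on UNIV m"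
    and cont: "\<And>i. i \<le> N \<Longrightarrow> continuous_on UNIV (\<phi> i)"
  shows "m (Bcontfun (\<lambda>x. \<Sum>i\<le>N. c i * \<phi> i x)) = (\<Sum>i\<le>N. c i * m (Bcontfun (\<phi> i)))"
  using cont
proof (induction N)
  case 0
  have "Bcontfun (\<lambda>x. c 0 * \<phi> 0 x) = scaleC_bcontfun (c 0) (Bcontfun (\<phi> 0))"
    using 0 by (simp add: scaleC_bcontfun_def Bcontfun_inverse_compact[OF compact])
  then show ?case
    using m by (simp add: bounded_functional_on_def)
next
  case (Suc N)
  have "continuous_on UNIV (\<lambda>x. \<Sum>i\<le>N. c i * \<phi> i x)"
    using Suc.prems by (intro continuous_intros) auto
  moreover have "continuous_on UNIV (\<lambda>x. \<Sum>i\<le>Suc N. c i * \<phi> i x)"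
    using Suc.prems by (intro continuous_intros) auto
  ultimately have "Bcontfun (\<lambda>x. \<Sum>i\<le>Suc N. c i * \<phi> i x) =
      Bcontfun (\<lambda>x. \<Sum>i\<le>N. c i * \<phi> i x) + scaleC_bcontfun (c (Suc N)) (Bcontfun (\<phi> (Suc N)))"
    using Suc.prems by (intro bcontfun_eqI) (simp add: Bcontfun_inverse_compact[OF compact])
  then show ?case
    using m Suc by (simp add: bounded_functional_on_def)
qed

lemma normalized_functional_const:
  fixes m :: "('a::topological_space \<Rightarrow>\<^sub>C complex) \<Rightarrow> complex"
  assumes "bounded_functional_on UNIV m" "m (const_bcontfun 1) = 1"
  shows "m (Bcontfun (\<lambda>x. c)) = c"
proof -
  have "Bcontfun (\<lambda>x::'a. c) = scaleC_bcontfun c (const_bcontfun 1)"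
    by (simp add: scaleC_bcontfun_def)
  with assms show ?thesis
    by (simp add: bounded_functional_on_def)
qed

text \<open>Averages of cochains are cochains; \<open>ins x s\<close> is \<open>s\<close> with \<open>x\<close> inserted at some position.
  The factor \<open>c\<close> accommodates the sign in the homotopy for a left invariant mean.\<close>

lemma average_mem_cochains:
  fixes f :: "(nat \<Rightarrow> 'a::topological_semigroup_mult) \<Rightarrow> complex"
    and m :: "('a \<Rightarrow>\<^sub>C complex) \<Rightarrow> complex"
  assumes compact: "compact (UNIV :: 'a set)"
    and m: "bounded_functional_on UNIV m"
    and f: "f \<in> carrier (cochains (Suc n))"
    and ins: "continuous_map (prod_topology (power_top n) euclidean) (power_top (Suc n))
                (\<lambda>(s, x). ins x s)"
  shows "(\<lambda>s\<in>topspace (power_top n). c * m (Bcontfun (\<lambda>x. f (ins x s)))) \<in> carrier (cochains n)"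
proof -
  obtain B where B: "\<And>s. s \<in> topspace (power_top (Suc n)) \<Longrightarrow> norm (f s) \<le> B"
    and cont: "continuous_map (power_top (Suc n)) euclidean f"
    using f unfolding carrier_cochains_iff by blast
  obtain K where K: "\<And>\<phi>. norm (m \<phi>) \<le> K * norm \<phi>"
    using m unfolding bounded_functional_on_def by auto
  have joint: "continuous_map (prod_topology (power_top n) euclidean) euclidean
      (\<lambda>(s, x). f (ins x s))"
    using continuous_map_compose[OF ins cont] by (simp add: o_def case_prod_unfold)
  have "continuous_map (power_top n) euclidean (\<lambda>s. m (Bcontfun (\<lambda>x. f (ins x s))))"
    using continuous_map_compose[OF continuous_map_Bcontfun[OF compact joint], of euclidean m]
      bounded_functional_on_continuous[OF m]
    by (simp add: o_def)
  then have "continuous_map (power_top n) euclidean (\<lambda>s. c * m (Bcontfun (\<lambda>x. f (ins x s))))"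
    by (intro continuous_map_times) auto
  moreover have "norm (c * m (Bcontfun (\<lambda>x. f (ins x s)))) \<le> norm c * (\<bar>K\<bar> * B)"
    if s: "s \<in> topspace (power_top n)" for s
  proof -
    have "continuous_on UNIV (\<lambda>x. f (ins x s))"
      using continuous_map_fix_first[OF joint s] by simp
    moreover have "ins x s \<in> topspace (power_top (Suc n))" for x
      using continuous_map_funspace[OF continuous_map_fix_first[OF ins s]]
      by (simp add: Pi_iff)
    ultimately have "norm (Bcontfun (\<lambda>x. f (ins x s))) \<le> B"
      by (intro norm_bound) (simp add: Bcontfun_inverse_compact[OF compact] B)
    then have "\<bar>K\<bar> * norm (Bcontfun (\<lambda>x. f (ins x s))) \<le> \<bar>K\<bar> * B"
      by (rule mult_left_mono) simp
    moreover have "K * norm (Bcontfun (\<lambda>x. f (ins x s))) \<le> \<bar>K\<bar> * norm (Bcontfun (\<lambda>x. f (ins x s)))"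
      by (rule mult_right_mono) auto
    ultimately have "norm (m (Bcontfun (\<lambda>x. f (ins x s)))) \<le> \<bar>K\<bar> * B"
      using K[of "Bcontfun (\<lambda>x. f (ins x s))"] by linarith
    then show ?thesis
      by (simp add: norm_mult mult_left_mono)
  qed
  ultimately show ?thesis
    by (rule restrict_mem_cochains)
qed

text \<open>The cocycle identity at \<open>ins x s\<close>, averaged over \<open>x\<close>. Invariance is left to the choice of
  \<open>ins\<close>, so the identity serves both the left and the right amenable case.\<close>

lemma averaged_cocycle_identity:
  fixes f :: "(nat \<Rightarrow> 'a::topological_semigroup_mult) \<Rightarrow> complex"
    and m :: "('a \<Rightarrow>\<^sub>C complex) \<Rightarrow> complex"
  assumes compact: "compact (UNIV :: 'a set)"
    and m: "bounded_functional_on UNIV m"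
    and f: "f \<in> cocycles n"
    and s: "s \<in> topspace (power_top n)"
    and ins: "continuous_map (prod_topology (power_top n) euclidean) (power_top (Suc n))
                (\<lambda>(s, x). ins x s)"
  shows "(\<Sum>i\<le>Suc n. (-1) ^ i * m (Bcontfun (\<lambda>x. f (merge_at n i (ins x s))))) = 0"
proof -
  have cont: "continuous_map (power_top n) euclidean f"
    using f by (simp add: cocycles_def kernel_def carrier_cochains_iff)
  have inss: "continuous_map euclidean (power_top (Suc n)) (\<lambda>x. ins x s)"
    by (rule continuous_map_fix_first[OF ins s])
  have "ins x s \<in> topspace (power_top (Suc n))" for x
    using continuous_map_funspace[OF inss] by (simp add: Pi_iff)
  then have "(\<Sum>i\<le>Suc n. (-1) ^ i * f (merge_at n i (ins x s))) = 0" for x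
    using f coboundary_eq_alternating_sum[of "ins x s" n f]
    by (simp add: cocycles_def kernel_def one_cochains del: sum.atMost_Suc)
  moreover have "continuous_on UNIV (\<lambda>x. f (merge_at n i (ins x s)))" for i
    using continuous_map_compose[OF continuous_map_compose[OF inss continuous_map_merge_at] cont]
    by (simp add: o_def)
  moreover have "m (Bcontfun (\<lambda>x. 0)) = 0"
  proof -
    have "Bcontfun (\<lambda>x::'a. 0) = scaleC_bcontfun 0 (const_bcontfun 1)"
      by (simp add: scaleC_bcontfun_def)
    with m show ?thesis
      by (simp add: bounded_functional_on_def)
  qed
  ultimately show ?thesis
    using bounded_functional_on_sum[OF compact m,
        of "Suc n" "\<lambda>i x. f (merge_at n i (ins x s))" "\<lambda>i. (-1) ^ i"] by simp
qed


section \<open>Contracting homotopies\<close>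

definition append_point :: "nat \<Rightarrow> 'a \<Rightarrow> (nat \<Rightarrow> 'a) \<Rightarrow> nat \<Rightarrow> 'a" where
  "append_point n x s = (\<lambda>j\<in>{1..Suc n}. if j = Suc n then x else s j)"

definition prepend_point :: "nat \<Rightarrow> 'a \<Rightarrow> (nat \<Rightarrow> 'a) \<Rightarrow> nat \<Rightarrow> 'a" where
  "prepend_point n x s = (\<lambda>j\<in>{1..Suc n}. if j = 1 then x else s (j - 1))"

lemma continuous_map_prod_power_top_coord:
  assumes "j \<in> {1..n}"
  shows "continuous_map (prod_topology (power_top n) X) euclidean (\<lambda>p. fst p j)"
  using continuous_map_compose[OF continuous_map_fst continuous_map_power_top_coord[OF assms]]
  by (simp add: o_def)

lemma continuous_map_append_point:
  "continuous_map (prod_topology (power_top n) euclidean) (power_top (Suc n))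
     (\<lambda>(s, x). append_point n x s)"
  unfolding case_prod_unfold
proof (rule continuous_map_into_power_top)
  fix j assume "j \<in> {1..Suc n}"
  then show "continuous_map (prod_topology (power_top n) euclidean) euclidean
      (\<lambda>p. append_point n (snd p) (fst p) j)"
    by (cases "j = Suc n")
       (auto simp: append_point_def continuous_map_snd intro!: continuous_map_prod_power_top_coord)
qed (simp add: append_point_def)

lemma continuous_map_prepend_point:
  "continuous_map (prod_topology (power_top n) euclidean) (power_top (Suc n))
     (\<lambda>(s, x). prepend_point n x s)"
  unfolding case_prod_unfold
proof (rule continuous_map_into_power_top)
  fix j assume "j \<in> {1..Suc n}"
  then show "continuous_map (prod_topology (power_top n) euclidean) euclidean
      (\<lambda>p. prepend_point n (snd p) (fst p) j)"
    by (cases "j = 1")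
       (auto simp: prepend_point_def continuous_map_snd intro!: continuous_map_prod_power_top_coord)
qed (simp add: prepend_point_def)

text \<open>How the faces interact with insertion at the end: all but the last two commute with it, the
  last but one multiplies the new point from the left, and the last one deletes it.\<close>

lemma merge_at_append_point:
  "i \<le> n \<Longrightarrow>
     merge_at (Suc n) i (append_point (Suc n) x s) = append_point n x (merge_at n i s)"
  "merge_at (Suc n) (Suc n) (append_point (Suc n) x s) =
     append_point n (s (Suc n) * x) (merge_at n (Suc n) s)"
  "s \<in> topspace (power_top (Suc n)) \<Longrightarrow>
     merge_at (Suc n) (Suc (Suc n)) (append_point (Suc n) x s) = s"
  by (auto simp: merge_at_def append_point_def fun_eq_iff topspace_power_top PiE_iff extensional_def le_Suc_eq)

text \<open>The mirror image: the first face deletes the new point, the second one multiplies it from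
  the right, and the others commute with insertion up to a shift of the index.\<close>

lemma merge_at_prepend_point:
  "s \<in> topspace (power_top (Suc n)) \<Longrightarrow> merge_at (Suc n) 0 (prepend_point (Suc n) x s) = s"
  "merge_at (Suc n) (Suc 0) (prepend_point (Suc n) x s) =
     prepend_point n (x * s 1) (merge_at n 0 s)"
  "i > 0 \<Longrightarrow>
     merge_at (Suc n) (Suc i) (prepend_point (Suc n) x s) = prepend_point n x (merge_at n i s)"
  by (auto simp: merge_at_def prepend_point_def fun_eq_iff topspace_power_top PiE_iff extensional_def Suc_le_eq)

text \<open>The last but one face of \<open>append_point (Suc n) x s\<close> translates \<open>x\<close> by \<open>s (Suc n)\<close> on the left,
  which the mean does not see. Hence all faces but the last average to the terms of the
  coboundary of \<open>h\<close>, and the last one gives back \<open>f s\<close>.\<close>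

lemma left_invariant_mean_cocycle_is_coboundary:
  fixes f :: "(nat \<Rightarrow> 'a::topological_semigroup_mult) \<Rightarrow> complex"
    and m :: "('a \<Rightarrow>\<^sub>C complex) \<Rightarrow> complex"
  assumes compact: "compact (UNIV :: 'a set)"
    and m: "bounded_functional_on UNIV m" "m (const_bcontfun 1) = 1"
    and inv: "\<And>s F. m (fun_dot F s) = m F"
    and f: "f \<in> cocycles (Suc n)"
  shows "f \<in> coboundaries (Suc n)"
proof -
  have carrier: "f \<in> carrier (cochains (Suc n))"
    using f by (simp add: cocycles_def kernel_def)
  define h where "h t = m (Bcontfun (\<lambda>x. f (append_point n x t)))" for t
  define g where "g = (\<lambda>t\<in>topspace (power_top n). (-1) ^ Suc n * h t)"
  have "g \<in> carrier (cochains n)"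
    unfolding g_def h_def
    by (rule average_mem_cochains[OF compact m(1) carrier continuous_map_append_point])
  moreover have "f = coboundary n g"
  proof
    fix s :: "nat \<Rightarrow> 'a"
    show "f s = coboundary n g s"
    proof (cases "s \<in> topspace (power_top (Suc n))")
      case s: True
      let ?F = "\<lambda>i. Bcontfun (\<lambda>x. f (merge_at (Suc n) i (append_point (Suc n) x s)))"
      have inner: "m (?F i) = h (merge_at n i s)" if "i \<le> Suc n" for i
      proof (cases "i = Suc n")
        case True
        let ?\<phi> = "\<lambda>x. f (append_point n x (merge_at n (Suc n) s))"
        have "continuous_map (power_top (Suc n)) euclidean f"
          using carrier by (simp add: carrier_cochains_iff)
        then have "continuous_on UNIV ?\<phi>"
          using continuous_map_compose[OF continuous_map_fix_first
              [OF continuous_map_append_point merge_at_mem]]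
          by (fastforce simp: o_def)
        then have "fun_dot (Bcontfun ?\<phi>) (s (Suc n)) = ?F (Suc n)"
          by (simp add: fun_dot_def Bcontfun_inverse_compact[OF compact] merge_at_append_point)
        with True inv[of "Bcontfun ?\<phi>" "s (Suc n)"] show ?thesis
          by (simp add: h_def)
      next
        case False
        with that show ?thesis
          by (simp add: h_def merge_at_append_point)
      qed
      have outer: "m (?F (Suc (Suc n))) = f s"
        using normalized_functional_const[OF m] s by (simp add: merge_at_append_point)
      have "(\<Sum>i\<le>Suc (Suc n). (-1) ^ i * m (?F i)) = 0"
        by (rule averaged_cocycle_identity[OF compact m(1) f s continuous_map_append_point])
      then have "(\<Sum>i\<le>Suc n. (-1) ^ i * h (merge_at n i s)) + (-1) ^ Suc (Suc n) * f s = 0"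
        using outer inner by (subst (asm) sum.atMost_Suc) simp
      then have "(\<Sum>i\<le>Suc n. (-1) ^ i * h (merge_at n i s)) = (-1) ^ Suc n * f s"
        by (simp add: eq_neg_iff_add_eq_0)
      moreover have "coboundary n g s = (-1) ^ Suc n * (\<Sum>i\<le>Suc n. (-1) ^ i * h (merge_at n i s))"
        unfolding coboundary_eq_alternating_sum[OF s] sum_distrib_left
        by (rule sum.cong) (simp_all add: g_def merge_at_mem)
      ultimately show ?thesis
        by (simp flip: power_mult_distrib mult.assoc)
    next
      case False
      with carrier show ?thesis
        by (simp add: carrier_cochains_iff extensional_def coboundary_def)
    qed
  qed
  ultimately show ?thesis
    by (simp add: coboundaries_def)
qed

text \<open>Here the deleting face is the first one, so that \<open>f s\<close> appears with sign \<open>+1\<close> and the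
  coboundary of the average with the shifted signs \<open>(-1)\<^bsup>i + 1\<^esup>\<close>.\<close>

lemma right_invariant_mean_cocycle_is_coboundary:
  fixes f :: "(nat \<Rightarrow> 'a::topological_semigroup_mult) \<Rightarrow> complex"
    and m :: "('a \<Rightarrow>\<^sub>C complex) \<Rightarrow> complex"
  assumes compact: "compact (UNIV :: 'a set)"
    and m: "bounded_functional_on UNIV m" "m (const_bcontfun 1) = 1"
    and inv: "\<And>s F. m (dot_fun s F) = m F"
    and f: "f \<in> cocycles (Suc n)"
  shows "f \<in> coboundaries (Suc n)"
proof -
  have carrier: "f \<in> carrier (cochains (Suc n))"
    using f by (simp add: cocycles_def kernel_def)
  define h where "h t = m (Bcontfun (\<lambda>x. f (prepend_point n x t)))" for t
  define g where "g = (\<lambda>t\<in>topspace (power_top n). h t)"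
  have "g \<in> carrier (cochains n)"
    using average_mem_cochains[OF compact m(1) carrier continuous_map_prepend_point, of 1]
    by (simp add: g_def h_def)
  moreover have "f = coboundary n g"
  proof
    fix s :: "nat \<Rightarrow> 'a"
    show "f s = coboundary n g s"
    proof (cases "s \<in> topspace (power_top (Suc n))")
      case s: True
      let ?F = "\<lambda>i. Bcontfun (\<lambda>x. f (merge_at (Suc n) i (prepend_point (Suc n) x s)))"
      have inner: "m (?F (Suc i)) = h (merge_at n i s)" for i
      proof (cases "i = 0")
        case True
        let ?\<phi> = "\<lambda>x. f (prepend_point n x (merge_at n 0 s))"
        have "continuous_map (power_top (Suc n)) euclidean f"
          using carrier by (simp add: carrier_cochains_iff)
        then have "continuous_on UNIV ?\<phi>"
          using continuous_map_compose[OF continuous_map_fix_first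
              [OF continuous_map_prepend_point merge_at_mem]]
          by (fastforce simp: o_def)
        then have "dot_fun (s 1) (Bcontfun ?\<phi>) = ?F (Suc 0)"
          by (simp add: dot_fun_def Bcontfun_inverse_compact[OF compact] merge_at_prepend_point)
        with True inv[of "s 1" "Bcontfun ?\<phi>"] show ?thesis
          by (simp add: h_def)
      next
        case False
        then show ?thesis
          by (simp add: h_def merge_at_prepend_point)
      qed
      have outer: "m (?F 0) = f s"
        using normalized_functional_const[OF m] s by (simp add: merge_at_prepend_point)
      have "(\<Sum>i\<le>Suc (Suc n). (-1) ^ i * m (?F i)) = 0"
        by (rule averaged_cocycle_identity[OF compact m(1) f s continuous_map_prepend_point])
      then have "f s + (\<Sum>i\<le>Suc n. (-1) ^ Suc i * h (merge_at n i s)) = 0"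
        using outer inner by (subst (asm) sum.atMost_Suc_shift) simp
      then have "f s = (\<Sum>i\<le>Suc n. (-1) ^ i * h (merge_at n i s))"
        by (simp add: sum_negf del: sum.atMost_Suc)
      also have "\<dots> = coboundary n g s"
        unfolding coboundary_eq_alternating_sum[OF s]
        by (rule sum.cong) (simp_all add: g_def merge_at_mem)
      finally show ?thesis .
    next
      case False
      with carrier show ?thesis
        by (simp add: carrier_cochains_iff extensional_def coboundary_def)
    qed
  qed
  ultimately show ?thesis
    by (simp add: coboundaries_def)
qed

theorem theorem4p2:
  fixes n :: nat
  assumes "compact (UNIV :: 'a::topological_semigroup_mult set)"
    and "left_amenable TYPE('a) \<or> right_amenable TYPE('a)"
    and "n \<ge> 1"
  shows "trivial_group (cb_cohomology TYPE('a) n)"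
proof -
  obtain k where n: "n = Suc k"
    using assms(3) by (cases n) auto
  have "cocycles (Suc k) \<subseteq> (coboundaries (Suc k) :: ((nat \<Rightarrow> 'a) \<Rightarrow> complex) set)"
    using assms(2)
  proof
    assume "left_amenable TYPE('a)"
    then show ?thesis
      using left_invariant_mean_cocycle_is_coboundary[OF assms(1)]
      by (auto simp: left_amenable_def RUC_eq_UNIV[OF assms(1)])
  next
    assume "right_amenable TYPE('a)"
    then show ?thesis
      using right_invariant_mean_cocycle_is_coboundary[OF assms(1)]
      by (auto simp: right_amenable_def LUC_eq_UNIV[OF assms(1)])
  qed
  then show ?thesis
    unfolding n by (rule trivial_cohomologyI)
qed

end
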